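(* Let $r\in\mathbb{N}$, $n\in\mathbb{Z}_+$ and $x\in\mathbb{Z}_p$. Define $$E_{n,w,q}^{(r)}(x)=\int_{\mathbb{Z}_p^r} w^{x_1+\cdots+x_r}\,[x+x_1+\cdots+x_r]_q^n\,d\mu_{-1}(x_1)\cdots d\mu_{-1}(x_r).$$ Then $$E_{n,w,q}^{(r)}(x)=2^r\sum_{m=0}^{\infty}\binom{m+r-1}{m}(-1)^m w^m [m+x]_q^n .$$
   Context: Let $p$ be a fixed odd prime, $\mathbb{Z}_p$ the ring of $p$-adic integers, $\mathbb{C}_p$ the completion of the algebraic closure of $\mathbb{Q}_p$, and $\mathbb{Z}_+=\mathbb{N}\cup\{0\}$. Let $q,w\in\mathbb{C}_p$ with $|1-q|_p<1$ and $|1-w|_p<1$. For $x\in\mathbb{Z}_p$ put $[x]_q=\frac{1-q^x}{1-q}$. For a uniformly differentiable function $f:\mathbb{Z}_p\to\mathbb{C}_p$, the fermionic $p$-adic integral is $\int_{\mathbb{Z}_p}f(x)\,d\mu_{-1}(x)=\lim_{N\to\infty}\sum_{x=0}^{p^N-1}f(x)(-1)^x$, and $\int_{\mathbb{Z}_p^r}$ denotes the $r$-fold iterated fermionic integral.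
   Formalization: The series on the right never converges in C_p (its terms do not tend to 0); it is read as the value at t=1 of the rational function of t whose expansion is the sum of its terms times t^m. For q=1, where the quotient is undefined, [x]_q is taken to be x. *)

theory Defs
  imports "HOL-Analysis.Analysis" "HOL-Computational_Algebra.Polynomial_FPS"
begin

text \<open>
  The field \<open>\<complex>\<^sub>p\<close> is a type \<open>'a\<close> whose metric is \<open>|x - y|\<^sub>p\<close>. The constant \<^const>\<open>norm\<close> is
  restricted to real vector spaces, so \<open>|x|\<^sub>p\<close> is expressed through the metric.
\<close>

definition padic_abs :: "'a::{field_char_0, metric_space} \<Rightarrow> real" where
  "padic_abs x = dist x 0"

definition padic_numbers :: "'a::{field_char_0, metric_space} set" where
  "padic_numbers = closure \<rat>"

definition padic_integers :: "'a::{field_char_0, metric_space} set" where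
  "padic_integers = {x \<in> padic_numbers. padic_abs x \<le> 1}"

definition padic_algebraic :: "'a::{field_char_0, metric_space} set" where
  "padic_algebraic =
     {x. \<exists>f. f \<noteq> 0 \<and> (\<forall>i. coeff f i \<in> padic_numbers) \<and> poly f x = 0}"

text \<open>
  \<open>'a\<close> is a completion of an algebraic closure of a completion of \<open>\<rat>\<close> with respect to \<open>|_|\<^sub>p\<close>,
  with the extended absolute value. This determines \<open>'a\<close> up to isometric isomorphism.
  Completeness of \<open>'a\<close>, and with it of the closure of \<open>\<rat>\<close>, is part of the class
  \<^class>\<open>complete_space\<close>.
\<close>

definition padic_complex_field ::
    "nat \<Rightarrow> 'a::{field_char_0, complete_space} itself \<Rightarrow> bool" where
  "padic_complex_field p T \<longleftrightarrow>
     (\<forall>x y::'a. dist x y = padic_abs (x - y)) \<and>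
     (\<forall>x y::'a. padic_abs (x * y) = padic_abs x * padic_abs y) \<and>
     (\<forall>x y::'a. padic_abs (x + y) \<le> max (padic_abs x) (padic_abs y)) \<and>
     (\<forall>k. k \<noteq> 0 \<longrightarrow> padic_abs (of_int k :: 'a) = (1 / real p) ^ multiplicity (int p) k) \<and>
     (\<forall>f::'a poly. degree f > 0 \<and> (\<forall>i. coeff f i \<in> padic_algebraic) \<longrightarrow>
        (\<exists>x\<in>padic_algebraic. poly f x = 0)) \<and>
     closure (padic_algebraic :: 'a set) = UNIV"

text \<open>
  \<open>q\<^sup>x\<close> for \<open>|1 - q|\<^sub>p < 1\<close> and \<open>x \<in> \<int>\<^sub>p\<close>: the value at \<open>x\<close> of the continuous extension of
  \<open>n \<mapsto> q\<^sup>n\<close> from the natural numbers, that is, the limit of \<open>q\<^sup>n\<close> as \<open>n\<close> tends to \<open>x\<close> p-adically.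
\<close>

definition padic_pow ::
    "'a::{field_char_0, metric_space} \<Rightarrow> 'a \<Rightarrow> 'a" where
  "padic_pow q x = Lim (filtercomap of_nat (nhds x)) (\<lambda>n::nat. q ^ n)"

text \<open>The case \<open>q = 1\<close> is the removable singularity: \<open>[x]\<^sub>q\<close> tends to \<open>x\<close> as \<open>q\<close> tends to 1.\<close>

definition q_bracket :: "'a::{field_char_0, metric_space} \<Rightarrow> 'a \<Rightarrow> 'a" where
  "q_bracket q x = (if q = 1 then x else (1 - padic_pow q x) / (1 - q))"

definition fermionic_integral ::
    "nat \<Rightarrow> ('a::{field_char_0, metric_space} \<Rightarrow> 'a) \<Rightarrow> 'a" where
  "fermionic_integral p f = lim (\<lambda>N. \<Sum>x<p ^ N. f (of_nat x) * (-1) ^ x)"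

primrec iterated_fermionic_integral ::
    "nat \<Rightarrow> nat \<Rightarrow> ('a::{field_char_0, metric_space} list \<Rightarrow> 'a) \<Rightarrow> 'a" where
  "iterated_fermionic_integral p 0 f = f []"
| "iterated_fermionic_integral p (Suc r) f =
     fermionic_integral p (\<lambda>y. iterated_fermionic_integral p r (\<lambda>ys. f (y # ys)))"

definition euler_poly ::
    "nat \<Rightarrow> nat \<Rightarrow> nat \<Rightarrow> 'a::{field_char_0, metric_space} \<Rightarrow> 'a \<Rightarrow> 'a \<Rightarrow> 'a" where
  "euler_poly p r n w q x =
     iterated_fermionic_integral p r
       (\<lambda>ys. padic_pow w (sum_list ys) * q_bracket q (x + sum_list ys) ^ n)"

text \<open>
  A series such as \<open>\<Sum>m. (-1)\<^sup>m w\<^sup>m\<close> with \<open>|w|\<^sub>p = 1\<close> does not converge in \<open>\<complex>\<^sub>p\<close>, its terms having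
  absolute value 1; it stands for the rational function \<open>1 / (1 + w)\<close> of which it is the formal
  expansion. Accordingly \<open>\<Sum>m. a m\<close> has the value \<open>s\<close> if the formal power series \<open>\<Sum>m. a m t\<^sup>m\<close> is the
  expansion of a rational function of \<open>t\<close> without pole at \<open>t = 1\<close>, and \<open>s\<close> is its value there.
  The value is unique, and it is the sum in the usual sense whenever the series converges.
\<close>

definition rational_sums :: "(nat \<Rightarrow> 'a::field) \<Rightarrow> 'a \<Rightarrow> bool" (infixr "rational'_sums" 80) where
  "a rational_sums s \<longleftrightarrow>
     (\<exists>f g. poly g 1 \<noteq> 0 \<and> fps_of_poly g * Abs_fps a = fps_of_poly f \<and>
            s = poly f 1 / poly g 1)"

definition rational_summable :: "(nat \<Rightarrow> 'a::field) \<Rightarrow> bool" where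
  "rational_summable a \<longleftrightarrow> (\<exists>s. a rational_sums s)"

definition rational_suminf :: "(nat \<Rightarrow> 'a::field) \<Rightarrow> 'a" where
  "rational_suminf a = (THE s. a rational_sums s)"

lemma rational_sums_unique2:
  assumes "a rational_sums s" "a rational_sums t"
  shows "s = t"
proof -
  obtain f g where 1: "poly g 1 \<noteq> 0" "fps_of_poly g * Abs_fps a = fps_of_poly f"
      "s = poly f 1 / poly g 1"
    using assms(1) unfolding rational_sums_def by blast
  obtain f' g' where 2: "poly g' 1 \<noteq> 0" "fps_of_poly g' * Abs_fps a = fps_of_poly f'"
      "t = poly f' 1 / poly g' 1"
    using assms(2) unfolding rational_sums_def by blast
  have "fps_of_poly (f * g') = fps_of_poly (f' * g)"
    unfolding fps_of_poly_mult 1(2)[symmetric] 2(2)[symmetric] by (simp add: mult_ac)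
  then have "f * g' = f' * g"
    by (simp only: fps_of_poly_eq_iff)
  then have "poly f 1 * poly g' 1 = poly f' 1 * poly g 1"
    by (metis poly_mult)
  with 1(1) 2(1) show ?thesis
    unfolding 1(3) 2(3) by (simp add: field_simps)
qed

lemma rational_suminf_eqI: "a rational_sums s \<Longrightarrow> rational_suminf a = s"
  unfolding rational_suminf_def by (blast intro: rational_sums_unique2)

lemma rational_sums_eq_sums:
  fixes a :: "nat \<Rightarrow> 'a::{field_char_0, complete_space}"
  assumes Cp: "padic_complex_field p TYPE('a)" and a: "a rational_sums s" "a sums s'"
  shows "s = s'"
proof -
  have dn: "dist x y = padic_abs (x - y)" and nm: "padic_abs (x * y) = padic_abs x * padic_abs y" 
    and nu: "padic_abs (x + y) \<le> max (padic_abs x) (padic_abs y)"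
    for x y :: 'a
    using Cp unfolding padic_complex_field_def by auto
  have nn: "padic_abs (x::'a) \<ge> 0" for x
    by (simp add: padic_abs_def)
  have tri: "padic_abs (x + y) \<le> padic_abs x + padic_abs y" for x y :: 'a
    using nu[of x y] nn[of x] nn[of y] by linarith
  have cmult: "(\<lambda>n. c * X n) \<longlonglongrightarrow> c * L" if "X \<longlonglongrightarrow> L" for c L :: 'a and X :: "nat \<Rightarrow> 'a"
  proof -
    have "(\<lambda>n. dist (c * X n) (c * L)) = (\<lambda>n. padic_abs c * dist (X n) L)"
      by (simp add: dn nm flip: right_diff_distrib)
    moreover have "(\<lambda>n. padic_abs c * dist (X n) L) \<longlonglongrightarrow> padic_abs c * 0"
      by (rule tendsto_mult[OF tendsto_const iffD1[OF tendsto_dist_iff that]])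
    ultimately have "(\<lambda>n. dist (c * X n) (c * L)) \<longlonglongrightarrow> 0"
      by simp
    then show ?thesis
      by (rule iffD2[OF tendsto_dist_iff])
  qed
  have add: "(\<lambda>n. X n + Y n) \<longlonglongrightarrow> L + M" if "X \<longlonglongrightarrow> L" "Y \<longlonglongrightarrow> M"
    for L M :: 'a and X Y :: "nat \<Rightarrow> 'a"
  proof -
    have "dist (X n + Y n) (L + M) \<le> dist (X n) L + dist (Y n) M" for n
      using tri[of "X n - L" "Y n - M"] by (simp add: dn algebra_simps)
    moreover have "(\<lambda>n. dist (X n) L + dist (Y n) M) \<longlonglongrightarrow> 0 + 0"
      by (rule tendsto_add[OF that[THEN iffD1[OF tendsto_dist_iff]]])
    ultimately have "(\<lambda>n. dist (X n + Y n) (L + M)) \<longlonglongrightarrow> 0"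
      by (auto intro: Lim_null_comparison[where g = "\<lambda>n. dist (X n) L + dist (Y n) M"])
    then show ?thesis
      by (rule iffD2[OF tendsto_dist_iff])
  qed
  have main: "(\<lambda>M. \<Sum>m<M. fps_nth (fps_of_poly g * Abs_fps a) m) \<longlonglongrightarrow> poly g 1 * s'" for g
  proof (induction g)
    case 0
    show ?case by simp
  next
    case (pCons c g)
    let ?A = "\<lambda>M. \<Sum>m<M. fps_nth (fps_of_poly g * Abs_fps a) m"
    have "(\<lambda>M. \<Sum>m<M. fps_nth (fps_of_poly (pCons c g) * Abs_fps a) m) =
          (\<lambda>M. c * (\<Sum>m<M. a m) + ?A (M - 1))"
    proof
      fix M
      have "(\<Sum>m<M. fps_nth (fps_X * (fps_of_poly g * Abs_fps a)) m) = ?A (M - 1)"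
        by (cases M) (simp_all add: sum.lessThan_Suc_shift del: sum.lessThan_Suc)
      then show "(\<Sum>m<M. fps_nth (fps_of_poly (pCons c g) * Abs_fps a) m) =
          c * (\<Sum>m<M. a m) + ?A (M - 1)"
        by (simp add: fps_of_poly_pCons ring_distribs sum.distrib sum_distrib_left mult_ac)
    qed
    moreover have "(\<lambda>M. ?A (M - 1)) \<longlonglongrightarrow> poly g 1 * s'"
      by (rule LIMSEQ_imp_Suc) (simp del: sum.lessThan_Suc add: pCons.IH)
    then have "(\<lambda>M. c * (\<Sum>m<M. a m) + ?A (M - 1)) \<longlonglongrightarrow> c * s' + poly g 1 * s'"
      using a(2) unfolding sums_def by (intro add[OF cmult])
    ultimately show ?case
      by (simp add: ring_distribs)
  qed
  obtain f g where fg: "poly g 1 \<noteq> 0" "fps_of_poly g * Abs_fps a = fps_of_poly f"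
      "s = poly f 1 / poly g 1"
    using a(1) unfolding rational_sums_def by blast
  have "(\<Sum>m<M. fps_nth (fps_of_poly f) m) = poly f 1" if "M > degree f" for M
  proof -
    have "(\<Sum>m<M. coeff f m) = (\<Sum>m\<le>degree f. coeff f m)"
      using that by (intro sum.mono_neutral_right) (auto simp: coeff_eq_0)
    then show ?thesis
      by (simp add: poly_altdef)
  qed
  then have "(\<lambda>M. \<Sum>m<M. fps_nth (fps_of_poly f) m) \<longlonglongrightarrow> poly f 1"
    by (intro tendsto_eventually eventually_mono[OF eventually_gt_at_top[of "degree f"]])
  with main[of g] fg show ?thesis
    by (auto dest: LIMSEQ_unique simp: field_simps)
qed

end

theory Submission
  imports Defs "HOL-Number_Theory.Cong"
begin

text \<open>
  The integrand is only ever evaluated at natural numbers, where it is a function \<open>F\<close> of the sum of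
  the variables, and \<open>F m = w\<^sup>m [x + m]\<^sub>q\<^sup>n\<close> is a linear combination of sequences \<open>u\<^sup>m m\<^sup>k\<close> with
  \<open>|1 - u|\<^sub>p < 1\<close>. For such \<open>F\<close> the function \<open>G t = \<integral> F (t + y) d\<mu>\<^sub>-\<^sub>1(y)\<close> is again of this form and
  satisfies \<open>G (t + 1) + G t = 2 F t\<close>, because the alternating sum telescopes and \<open>p\<^sup>N \<rightarrow> 0\<close>.
  Summation by parts together with Pascal's rule turns the series of order \<open>r + 1\<close> for \<open>F\<close> into half
  the series of order \<open>r\<close> for \<open>G\<close>; at order 0 only the term \<open>G 0\<close> is left. Rational summability
  holds because \<open>\<Sum>m. C(m+r-1, m) (-u)\<^sup>m m\<^sup>k t\<^sup>m\<close> has its only pole at \<open>t = -1/u\<close>, and \<open>1 + u\<close> is a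
  unit for odd \<open>p\<close>.
\<close>

section \<open>Rational summation\<close>

lemma rational_sums_add:
  assumes "a rational_sums s" "b rational_sums t"
  shows "(\<lambda>m. a m + b m) rational_sums (s + t)"
proof -
  obtain f g where 1: "poly g 1 \<noteq> 0" "fps_of_poly g * Abs_fps a = fps_of_poly f"
      "s = poly f 1 / poly g 1"
    using assms(1) unfolding rational_sums_def by blast
  obtain f' g' where 2: "poly g' 1 \<noteq> 0" "fps_of_poly g' * Abs_fps b = fps_of_poly f'"
      "t = poly f' 1 / poly g' 1"
    using assms(2) unfolding rational_sums_def by blast
  have "Abs_fps (\<lambda>m. a m + b m) = Abs_fps a + Abs_fps b"
    by (simp add: fps_eq_iff)
  then have "fps_of_poly (g * g') * Abs_fps (\<lambda>m. a m + b m) =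
      fps_of_poly g' * (fps_of_poly g * Abs_fps a) + fps_of_poly g * (fps_of_poly g' * Abs_fps b)"
    by (simp add: fps_of_poly_mult algebra_simps)
  also have "\<dots> = fps_of_poly (g' * f + g * f')"
    unfolding 1(2) 2(2) by (simp add: fps_of_poly_mult fps_of_poly_add)
  finally have "fps_of_poly (g * g') * Abs_fps (\<lambda>m. a m + b m) = fps_of_poly (g' * f + g * f')" .
  moreover have "s + t = poly (g' * f + g * f') 1 / poly (g * g') 1"
    using 1(1,3) 2(1,3) by (simp add: add_frac_eq mult_ac)
  moreover have "poly (g * g') 1 \<noteq> 0"
    using 1(1) 2(1) by simp
  ultimately show ?thesis
    unfolding rational_sums_def by blast
qed

lemma rational_sums_cmult:
  assumes "a rational_sums s"
  shows "(\<lambda>m. c * a m) rational_sums (c * s)"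
proof -
  obtain f g where 1: "poly g 1 \<noteq> 0" "fps_of_poly g * Abs_fps a = fps_of_poly f"
      "s = poly f 1 / poly g 1"
    using assms(1) unfolding rational_sums_def by blast
  have "Abs_fps (\<lambda>m. c * a m) = fps_const c * Abs_fps a"
    by (simp add: fps_eq_iff)
  then have "fps_of_poly g * Abs_fps (\<lambda>m. c * a m) = fps_const c * (fps_of_poly g * Abs_fps a)"
    by (simp add: algebra_simps)
  also have "\<dots> = fps_of_poly (smult c f)"
    unfolding 1(2) by (simp add: fps_of_poly_smult)
  finally show ?thesis
    unfolding rational_sums_def using 1(1,3)
    by (intro exI[of _ "smult c f"] exI[of _ g]) simp
qed

text \<open>Shifting multiplies the generating function by \<open>fps_X\<close>, whose value at 1 is
  1.\<close>

lemma rational_sums_shift: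
  assumes "a rational_sums s"
  shows "(\<lambda>m. case m of 0 \<Rightarrow> 0 | Suc k \<Rightarrow> a k) rational_sums s"
proof -
  obtain f g where 1: "poly g 1 \<noteq> 0" "fps_of_poly g * Abs_fps a = fps_of_poly f"
      "s = poly f 1 / poly g 1"
    using assms(1) unfolding rational_sums_def by blast
  have "Abs_fps (\<lambda>m. case m of 0 \<Rightarrow> 0 | Suc k \<Rightarrow> a k) = fps_X * Abs_fps a"
    by (auto simp: fps_eq_iff split: nat.splits)
  then have "fps_of_poly g * Abs_fps (\<lambda>m. case m of 0 \<Rightarrow> 0 | Suc k \<Rightarrow> a k) =
      fps_X * (fps_of_poly g * Abs_fps a)"
    by (simp add: algebra_simps)
  also have "\<dots> = fps_of_poly (pCons 0 f)"
    unfolding 1(2) by (simp add: fps_of_poly_pCons algebra_simps)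
  finally show ?thesis
    unfolding rational_sums_def using 1(1,3)
    by (intro exI[of _ "pCons 0 f"] exI[of _ g]) simp
qed

text \<open>
  For \<open>r = 0\<close> truncated subtraction makes this the indicator of \<open>m = 0\<close>, as the expansion of
  \<open>(1 + t)\<^sup>-\<^sup>r\<close> requires.
\<close>

definition neg_binomial :: "nat \<Rightarrow> nat \<Rightarrow> 'a::comm_ring_1" where
  "neg_binomial r m = of_nat ((m + r - 1) choose m) * (-1) ^ m"

lemma neg_binomial_0 [simp]: "neg_binomial r 0 = 1"
  by (simp add: neg_binomial_def)

lemma neg_binomial_0_Suc [simp]: "neg_binomial 0 (Suc m) = 0"
  by (simp add: neg_binomial_def binomial_eq_0)

text \<open>With the signs included, Pascal's rule is the coefficient form of (1 + t) (1 + t)^(-r-1)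
  = (1 + t)^(-r).\<close>

lemma neg_binomial_Pascal:
  "neg_binomial (Suc r) (Suc m) + neg_binomial (Suc r) m = (neg_binomial r (Suc m) :: 'a::comm_ring_1)"
  by (simp add: neg_binomial_def algebra_simps)

lemma neg_binomial_series:
  fixes u :: "'a::field"
  shows "(1 + fps_const u * fps_X) ^ r * Abs_fps (\<lambda>m. neg_binomial r m * u ^ m) = 1"
proof (induction r)
  case 0
  have "Abs_fps (\<lambda>m. neg_binomial 0 m * u ^ m) = 1"
    by (rule fps_ext) (case_tac n; simp)
  then show ?case by simp
next
  case (Suc r)
  have "(1 + fps_const u * fps_X) * Abs_fps (\<lambda>m. neg_binomial (Suc r) m * u ^ m) =
      Abs_fps (\<lambda>m. neg_binomial r m * u ^ m)" (is "?l = ?r")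
  proof (rule fps_ext)
    fix m
    show "fps_nth ?l m = fps_nth ?r m"
      using neg_binomial_Pascal[of r "m - 1", where 'a = 'a, symmetric]
      by (cases m) (simp_all add: ring_distribs mult_ac)
  qed
  with Suc show ?case
    by (simp only: power_Suc2 mult.assoc)
qed

text \<open>Each factor m comes from applying t d/dt, which can raise the order of the pole at t =
  -1/u but creates no other pole.\<close>

lemma neg_binomial_exp_pow_series:
  fixes u :: "'a::field"
  shows "\<exists>N f. (1 + fps_const u * fps_X) ^ N *
    Abs_fps (\<lambda>m. neg_binomial r m * u ^ m * of_nat m ^ k) = fps_of_poly f"
proof (induction k)
  case 0
  show ?case
    using neg_binomial_series[of u r] by (intro exI[of _ r] exI[of _ 1]) simp
next
  case (Suc k)
  let ?L = "1 + fps_const u * fps_X"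
  let ?A = "Abs_fps (\<lambda>m. neg_binomial r m * u ^ m * of_nat m ^ k)"
  from Suc obtain N f where "?L ^ N * ?A = fps_of_poly f" by blast
  \<comment> \<open>The spare factor \<open>?L\<close> makes the product rule below leave, besides
    the wanted term, only a multiple of \<open>?L ^ N * ?A\<close>, already known to be a
    polynomial.\<close>
  then have f: "?L ^ Suc N * ?A = fps_of_poly ([:1, u:] * f)"
    by (simp add: fps_of_poly_mult fps_of_poly_pCons algebra_simps)
  have eq: "Abs_fps (\<lambda>m. neg_binomial r m * u ^ m * of_nat m ^ Suc k) = fps_X * fps_deriv ?A"
    by (rule fps_ext) (case_tac n; simp add: algebra_simps)
  have "fps_deriv (?L ^ Suc N * ?A) =
      of_nat (Suc N) * fps_const u * ?L ^ N * ?A + ?L ^ Suc N * fps_deriv ?A"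
    by (simp only: fps_deriv_mult fps_deriv_power) (simp add: fps_of_nat mult_ac del: of_nat_Suc power_Suc)
  then have "?L ^ Suc N * fps_deriv ?A =
      fps_of_poly (pderiv ([:1, u:] * f)) - of_nat (Suc N) * fps_const u * (?L ^ N * ?A)"
    unfolding f by (simp add: fps_of_poly_pderiv algebra_simps)
  also have "\<dots> = fps_of_poly (pderiv ([:1, u:] * f) - smult (of_nat (Suc N) * u) f)"
    unfolding \<open>?L ^ N * ?A = fps_of_poly f\<close>
    by (simp add: fps_of_poly_diff fps_of_poly_smult fps_of_nat flip: fps_const_mult
        del: of_nat_Suc)
  finally have "fps_X * (?L ^ Suc N * fps_deriv ?A) =
      fps_of_poly (pCons 0 (pderiv ([:1, u:] * f) - smult (of_nat (Suc N) * u) f))"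
    by (simp add: fps_of_poly_pCons)
  then have "?L ^ Suc N * (fps_X * fps_deriv ?A) =
      fps_of_poly (pCons 0 (pderiv ([:1, u:] * f) - smult (of_nat (Suc N) * u) f))"
    by (simp only: mult.left_commute)
  then show ?case
    unfolding eq by blast
qed

text \<open>The hypothesis says that the denominator (1 + u t)^N does not vanish at t = 1.\<close>

lemma rational_summable_neg_binomial_exp_pow:
  fixes u :: "'a::field"
  assumes "1 + u \<noteq> 0"
  shows "rational_summable (\<lambda>m. neg_binomial r m * (u ^ m * of_nat m ^ k))"
proof -
  obtain N f where "(1 + fps_const u * fps_X) ^ N *
      Abs_fps (\<lambda>m. neg_binomial r m * u ^ m * of_nat m ^ k) = fps_of_poly f"
    using neg_binomial_exp_pow_series by blast
  moreover have "(1 + fps_const u * fps_X) ^ N = fps_of_poly ([:1, u:] ^ N)"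
    by (simp add: fps_of_poly_power fps_of_poly_pCons)
  ultimately show ?thesis
    unfolding rational_summable_def rational_sums_def using assms
    by (intro exI[of _ "poly f 1 / poly ([:1, u:] ^ N) 1"] exI[of _ f] exI[of _ "[:1, u:] ^ N"])
      (simp add: mult.assoc)
qed

text \<open>Moving the \<open>G (Suc m)\<close> series up by one index lets Pascal's rule merge the
  two coefficients of each \<open>G m\<close>. Both series are assumed summable because the sum is
  split into them.\<close>

lemma rational_sums_neg_binomial_by_parts:
  fixes G :: "nat \<Rightarrow> 'a::field"
  assumes "rational_summable (\<lambda>m. neg_binomial (Suc r) m * G m)"
    and "rational_summable (\<lambda>m. neg_binomial (Suc r) m * G (Suc m))"
    and "(\<lambda>m. neg_binomial r m * G m) rational_sums s"
  shows "(\<lambda>m. neg_binomial (Suc r) m * (G (Suc m) + G m)) rational_sums s"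
proof -
  obtain s1 s2 where s: "(\<lambda>m. neg_binomial (Suc r) m * G m) rational_sums s1"
      "(\<lambda>m. neg_binomial (Suc r) m * G (Suc m)) rational_sums s2"
    using assms(1,2) unfolding rational_summable_def by blast
  have "(\<lambda>m. neg_binomial (Suc r) m * G m +
      (case m of 0 \<Rightarrow> 0 | Suc k \<Rightarrow> neg_binomial (Suc r) k * G (Suc k))) =
      (\<lambda>m. neg_binomial r m * G m)" (is "?l = _")
  proof
    fix m
    show "?l m = neg_binomial r m * G m"
      using neg_binomial_Pascal[of r "m - 1", where 'a = 'a, symmetric]
      by (cases m) (simp_all add: ring_distribs)
  qed
  with rational_sums_add[OF s(1) rational_sums_shift[OF s(2)]]
  have "s1 + s2 = s"
    using assms(3) rational_sums_unique2 by fastforce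
  with rational_sums_add[OF s(2) s(1)] show ?thesis
    by (simp add: ring_distribs add.commute)
qed

section \<open>Ultrametric preliminaries\<close>

locale padic_complex =
  fixes p :: nat and T :: "'a::{field_char_0, complete_space} itself"
  assumes prime_p: "prime p" and odd_p: "odd p" and Cp: "padic_complex_field p T"
begin

lemma dist_eq: "dist x y = padic_abs (x - y :: 'a)"
  and pabs_mult: "padic_abs (x * y :: 'a) = padic_abs x * padic_abs y"
  and pabs_add: "padic_abs (x + y :: 'a) \<le> max (padic_abs x) (padic_abs y)"
  and pabs_of_int: "k \<noteq> 0 \<Longrightarrow> padic_abs (of_int k :: 'a) = (1 / real p) ^ multiplicity (int p) k"
  using Cp unfolding padic_complex_field_def by auto

lemma p_gt_1: "p > 1"
  using prime_p prime_gt_1_nat by blast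

lemma pabs_0 [simp]: "padic_abs (0::'a) = 0"
  by (simp add: padic_abs_def)

lemma pabs_1 [simp]: "padic_abs (1::'a) = 1"
  using pabs_of_int[of 1] by simp

lemma pabs_nonneg [simp]: "padic_abs (x::'a) \<ge> 0"
  by (simp add: padic_abs_def)

lemma pabs_power: "padic_abs (x ^ n :: 'a) = padic_abs x ^ n"
  by (induction n) (simp_all add: pabs_mult)

lemma pabs_minus_commute: "padic_abs (x - y :: 'a) = padic_abs (y - x)"
  by (metis dist_commute dist_eq)

lemma pabs_minus [simp]: "padic_abs (- x :: 'a) = padic_abs x"
  using pabs_minus_commute[of 0 x] by simp

lemma pabs_diff: "padic_abs (x - y :: 'a) \<le> max (padic_abs x) (padic_abs y)"
  using pabs_add[of x "- y"] by simp

lemma pabs_trans: "padic_abs (x - z :: 'a) \<le> max (padic_abs (x - y)) (padic_abs (y - z))"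
  using pabs_add[of "x - y" "y - z"] by simp

text \<open>Isosceles principle: in 1 = (1 - u) + u the first summand is too small to have absolute
  value 1.\<close>

lemma pabs_eq_1:
  assumes "padic_abs (1 - u :: 'a) < 1"
  shows "padic_abs u = 1"
  using pabs_diff[of 1 "1 - u"] pabs_add[of "1 - u" u] assms by simp

lemma pabs_sum_le:
  assumes "\<And>i. i \<in> A \<Longrightarrow> padic_abs (f i :: 'a) \<le> B" "B \<ge> 0"
  shows "padic_abs (sum f A) \<le> B"
  using assms
proof (induction A rule: infinite_finite_induct)
  case (insert x F)
  then show ?case
    using pabs_add[of "f x" "sum f F"] by fastforce
qed simp_all

lemma pabs_of_int_le:
  assumes "int p ^ k dvd a"
  shows "padic_abs (of_int a :: 'a) \<le> (1 / real p) ^ k"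
proof (cases "a = 0")
  case False
  then have "k \<le> multiplicity (int p) a"
    using assms p_gt_1 by (intro multiplicity_geI) auto
  then show ?thesis
    using False p_gt_1 by (simp add: pabs_of_int power_decreasing)
qed (use p_gt_1 in simp)

lemma pabs_of_int_eq_1:
  assumes "\<not> int p dvd a"
  shows "padic_abs (of_int a :: 'a) = 1"
  using assms by (cases "a = 0") (simp_all add: pabs_of_int not_dvd_imp_multiplicity_0)

lemma dvd_if_pabs_of_int_less:
  assumes "padic_abs (of_int a :: 'a) < (1 / real p) ^ k"
  shows "int p ^ k dvd a"
proof (cases "a = 0")
  case False
  then have "(1 / real p) ^ multiplicity (int p) a < (1 / real p) ^ k"
    using assms by (simp add: pabs_of_int)
  then have "k \<le> multiplicity (int p) a"
    using p_gt_1 by (simp add: power_one_over frac_less2 field_simps)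
  then show ?thesis
    by (rule multiplicity_dvd')
qed simp

lemma inverse_p_power_tendsto_0: "(\<lambda>k. (1 / real p) ^ k) \<longlonglongrightarrow> 0"
  using p_gt_1 by (intro LIMSEQ_realpow_zero) auto

text \<open>For u = -1 the distance from 1 would be |2|, which is 1 because p is odd.\<close>

lemma one_plus_neq_0:
  assumes "padic_abs (1 - u :: 'a) < 1"
  shows "1 + u \<noteq> 0"
proof
  assume "1 + u = 0"
  then have "u = -1" by (simp add: eq_neg_iff_add_eq_0 add.commute)
  moreover have "\<not> int p dvd 2"
  proof
    assume "int p dvd 2"
    then have "p dvd 2"
      using int_dvd_int_iff[of p 2] by simp
    with prime_p have "p = 2"
      by (simp add: primes_dvd_imp_eq)
    with odd_p show False by simp
  qed
  then have "padic_abs (2 :: 'a) = 1"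
    using pabs_of_int_eq_1[of 2] by simp
  ultimately show False
    using assms by simp
qed

section \<open>Continuity of the ring operations, derived from the absolute value\<close>

lemma tendsto_pabs_iff:
  "(f \<longlongrightarrow> (l::'a)) F \<longleftrightarrow> ((\<lambda>x. padic_abs (f x - l)) \<longlongrightarrow> 0) F"
  by (subst tendsto_dist_iff) (simp add: dist_eq)

lemma tendsto_padic_mult:
  assumes "(f \<longlongrightarrow> (l::'a)) F" "(g \<longlongrightarrow> m) F"
  shows "((\<lambda>x. f x * g x) \<longlongrightarrow> l * m) F"
proof -
  let ?h = "\<lambda>x. padic_abs (f x - l) * padic_abs (g x - m) + padic_abs l * padic_abs (g x - m) +
    padic_abs (f x - l) * padic_abs m"
  have "padic_abs (f x * g x - l * m) \<le> ?h x" for x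
  proof -
    have "f x * g x - l * m = (f x - l) * (g x - m) + l * (g x - m) + (f x - l) * m"
      by (simp add: algebra_simps)
    also have "padic_abs \<dots> \<le> max (max (padic_abs ((f x - l) * (g x - m))) (padic_abs (l * (g x - m))))
        (padic_abs ((f x - l) * m))"
      by (meson max.mono order_refl order_trans pabs_add)
    also have "\<dots> \<le> ?h x"
      by (simp add: pabs_mult)
    finally show ?thesis .
  qed
  moreover have "(?h \<longlongrightarrow> 0 * 0 + padic_abs l * 0 + 0 * padic_abs m) F"
    using assms unfolding tendsto_pabs_iff by (intro tendsto_intros)
  ultimately show ?thesis
    unfolding tendsto_pabs_iff
    by - (rule Lim_null_comparison[where g = ?h], simp_all)
qed

lemma tendsto_padic_add:
  assumes "(f \<longlongrightarrow> (l::'a)) F" "(g \<longlongrightarrow> m) F"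
  shows "((\<lambda>x. f x + g x) \<longlongrightarrow> l + m) F"
proof -
  let ?h = "\<lambda>x. padic_abs (f x - l) + padic_abs (g x - m)"
  have "padic_abs (f x + g x - (l + m)) \<le> ?h x" for x
    using pabs_add[of "f x - l" "g x - m"] pabs_nonneg[of "f x - l"] pabs_nonneg[of "g x - m"]
    unfolding add_diff_add by linarith
  moreover have "(?h \<longlongrightarrow> 0 + 0) F"
    using assms unfolding tendsto_pabs_iff by (intro tendsto_intros)
  ultimately show ?thesis
    unfolding tendsto_pabs_iff
    by - (rule Lim_null_comparison[where g = ?h], simp_all)
qed

lemma tendsto_padic_power:
  assumes "(f \<longlongrightarrow> (l::'a)) F"
  shows "((\<lambda>x. f x ^ k) \<longlongrightarrow> l ^ k) F"
  by (induction k) (auto intro: tendsto_padic_mult assms)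

section \<open>The powers \<open>q\<^sup>x\<close>\<close>

lemma pabs_one_minus_mult:
  assumes "padic_abs (1 - u :: 'a) < 1" "padic_abs (1 - v) < 1"
  shows "padic_abs (1 - u * v) < 1"
proof -
  have "1 - u * v = (1 - u) + u * (1 - v)"
    by (simp add: algebra_simps)
  also have "padic_abs \<dots> \<le> max (padic_abs (1 - u)) (padic_abs (u * (1 - v)))"
    by (rule pabs_add)
  also have "\<dots> < 1"
    using assms pabs_eq_1[OF assms(1)] by (simp add: pabs_mult)
  finally show ?thesis .
qed

text \<open>1 - q^n is 1 - q times a geometric sum of elements of absolute value 1.\<close>

lemma pabs_one_minus_power_le:
  assumes "padic_abs (1 - q :: 'a) < 1"
  shows "padic_abs (1 - q ^ n) \<le> padic_abs (1 - q)"
proof -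
  have "padic_abs (\<Sum>i<n. q ^ i) \<le> 1"
    by (rule pabs_sum_le) (simp_all add: pabs_power pabs_eq_1[OF assms])
  then show ?thesis
    using mult_left_mono[of "padic_abs (\<Sum>i<n. q ^ i)" 1 "padic_abs (1 - q)"]
    by (simp add: one_diff_power_eq pabs_mult)
qed

text \<open>The cofactor 1 + q + ... + q^(p-1) of 1 - q differs from p only by terms 1 - q^i, so it
  is small as well.\<close>

lemma pabs_one_minus_power_p_le:
  assumes "padic_abs (1 - q :: 'a) < 1"
  shows "padic_abs (1 - q ^ p) \<le> padic_abs (1 - q) * max (1 / real p) (padic_abs (1 - q))"
proof -
  have "(\<Sum>i<p. q ^ i) = of_nat p - (\<Sum>i<p. 1 - q ^ i)"
    by (simp add: sum_subtractf)
  also have "padic_abs \<dots> \<le> max (padic_abs (of_nat p :: 'a)) (padic_abs (\<Sum>i<p. 1 - q ^ i))"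
    by (rule pabs_diff)
  also have "\<dots> \<le> max (1 / real p) (padic_abs (1 - q))"
    using pabs_of_int_le[of 1 "int p"]
    by (intro max.mono pabs_sum_le pabs_one_minus_power_le assms) simp_all
  finally show ?thesis
    by (simp add: one_diff_power_eq pabs_mult mult_left_mono)
qed

lemma pabs_one_minus_power_p_power_le:
  assumes "padic_abs (1 - q :: 'a) < 1"
  shows "padic_abs (1 - q ^ p ^ k) \<le> max (1 / real p) (padic_abs (1 - q)) ^ k"
proof (induction k)
  case 0
  show ?case using assms by simp
next
  case (Suc k)
  let ?M = "max (1 / real p) (padic_abs (1 - q))"
  have le: "padic_abs (1 - q ^ p ^ k) \<le> padic_abs (1 - q)"
    by (rule pabs_one_minus_power_le[OF assms])
  have "padic_abs (1 - (q ^ p ^ k) ^ p) \<le>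
      padic_abs (1 - q ^ p ^ k) * max (1 / real p) (padic_abs (1 - q ^ p ^ k))"
    using le assms by (intro pabs_one_minus_power_p_le) simp
  also have "\<dots> \<le> ?M ^ k * ?M"
    using le by (intro mult_mono Suc max.mono order_refl) (simp_all add: le_max_iff_disj)
  finally show ?case
    by (simp add: mult.commute flip: power_mult)
qed

text \<open>If a and b are close, then p^k divides their difference, and up to sign q^a - q^b is a
  power of q times 1 - (q^(p^k))^c, which is small by the preceding estimates.\<close>

lemma power_uniformly_continuous:
  assumes q: "padic_abs (1 - q :: 'a) < 1" and e: "e > 0"
  shows "\<exists>d>0. \<forall>a b::nat. padic_abs (of_nat a - of_nat b :: 'a) < d \<longrightarrow> padic_abs (q ^ a - q ^ b) < e"
proof -
  have "(\<lambda>k. max (1 / real p) (padic_abs (1 - q)) ^ k) \<longlonglongrightarrow> 0"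
    using q p_gt_1 by (intro LIMSEQ_realpow_zero) (auto simp: le_max_iff_disj)
  then obtain k where k: "max (1 / real p) (padic_abs (1 - q)) ^ k < e"
    using e by (metis (no_types, lifting) eventually_sequentially order_refl order_tendstoD(2))
  have main: "padic_abs (q ^ a - q ^ b) < e"
    if "b \<le> a" "padic_abs (of_nat a - of_nat b :: 'a) < (1 / real p) ^ k" for a b
  proof -
    have "int p ^ k dvd int (a - b)"
      using that by (intro dvd_if_pabs_of_int_less) (simp add: of_nat_diff)
    then have "p ^ k dvd a - b"
      by (metis of_nat_dvd_iff of_nat_power)
    then obtain c where c: "a - b = p ^ k * c" ..
    have "padic_abs (q ^ a - q ^ b) = padic_abs (q ^ b * (1 - q ^ (a - b)))"
      using that(1) by (subst pabs_minus_commute) (simp add: right_diff_distrib flip: power_add)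
    also have "\<dots> = padic_abs (1 - (q ^ p ^ k) ^ c)"
      by (simp add: pabs_mult pabs_power pabs_eq_1[OF q] c power_mult)
    also have "\<dots> \<le> padic_abs (1 - q ^ p ^ k)"
      using pabs_one_minus_power_le[OF q, of "p ^ k"] q by (intro pabs_one_minus_power_le) simp
    also have "\<dots> < e"
      using pabs_one_minus_power_p_power_le[OF q, of k] k by simp
    finally show ?thesis .
  qed
  have "padic_abs (q ^ a - q ^ b) < e" if "padic_abs (of_nat a - of_nat b :: 'a) < (1 / real p) ^ k"
    for a b
    using main[of a b] main[of b a] that by (metis linear pabs_minus_commute)
  then show ?thesis
    using p_gt_1 by (intro exI[of _ "(1 / real p) ^ k"]) auto
qed

text \<open>Uniform continuity makes the powers a Cauchy sequence; completeness gives a limit, which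
  is then shown to be the limit along the whole filter in \<open>padic_pow\<close>.\<close>

lemma tendsto_padic_pow:
  fixes x :: 'a and s :: "nat \<Rightarrow> nat"
  assumes q: "padic_abs (1 - q :: 'a) < 1" and s: "(\<lambda>i. of_nat (s i)) \<longlonglongrightarrow> x"
  shows "(\<lambda>i. q ^ s i) \<longlonglongrightarrow> padic_pow q x"
proof -
  have "Cauchy (\<lambda>i. q ^ s i)"
    unfolding Cauchy_def
  proof (intro allI impI)
    fix e :: real assume "e > 0"
    then obtain d where d: "d > 0"
      "\<And>a b. padic_abs (of_nat a - of_nat b :: 'a) < d \<Longrightarrow> padic_abs (q ^ a - q ^ b) < e"
      using power_uniformly_continuous[OF q] by blast
    from s have "Cauchy (\<lambda>i. of_nat (s i) :: 'a)"
      by (rule LIMSEQ_imp_Cauchy)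
    with d show "\<exists>M. \<forall>m\<ge>M. \<forall>n\<ge>M. dist (q ^ s m) (q ^ s n) < e"
      unfolding Cauchy_def dist_eq by meson
  qed
  then obtain L where L: "(\<lambda>i. q ^ s i) \<longlonglongrightarrow> L"
    using Cauchy_convergent convergent_def by blast
  let ?F = "filtercomap of_nat (nhds x) :: nat filter"
  have sF: "filterlim s ?F sequentially"
    using s by (simp add: filterlim_filtercomap_iff o_def)
  \<comment> \<open>\<open>Lim\<close> is determined only along a proper filter; the sequence
    \<open>s\<close> witnesses properness.\<close>
  have nb: "?F \<noteq> bot"
    using sF unfolding filterlim_def
    by (metis bot.extremum_uniqueI filtermap_bot_iff sequentially_bot)
  have "((\<lambda>n. q ^ n) \<longlongrightarrow> L) ?F"
  proof (rule tendstoI)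
    fix e :: real assume "e > 0"
    then obtain d where d: "d > 0"
      "\<And>a b. padic_abs (of_nat a - of_nat b :: 'a) < d \<Longrightarrow> padic_abs (q ^ a - q ^ b) < e"
      using power_uniformly_continuous[OF q] by blast
    \<comment> \<open>A single index i with both properties serves as intermediate point for all n
      close to x.\<close>
    have "eventually (\<lambda>i. dist (of_nat (s i)) x < d \<and> dist (q ^ s i) L < e) sequentially"
      using tendstoD[OF s \<open>d > 0\<close>] tendstoD[OF L \<open>e > 0\<close>] by (rule eventually_conj)
    then obtain i where i: "dist (of_nat (s i)) x < d" "dist (q ^ s i) L < e"
      by (auto simp: eventually_sequentially)
    have "dist (q ^ n) L < e" if "dist (of_nat n) x < d" for n
    proof -
      have "padic_abs (of_nat n - of_nat (s i) :: 'a) < d"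
        using pabs_trans[of "of_nat n" "of_nat (s i)" x] i(1) that
        by (simp add: dist_eq pabs_minus_commute[of x])
      with d(2) i(2) show ?thesis
        using pabs_trans[of "q ^ n" L "q ^ s i"] by (fastforce simp: dist_eq)
    qed
    moreover have "eventually (\<lambda>y. dist y x < d) (nhds x)"
      using \<open>d > 0\<close> by (auto simp: eventually_nhds_metric)
    ultimately show "eventually (\<lambda>n. dist (q ^ n) L < e) ?F"
      by (auto simp: eventually_filtercomap)
  qed
  then have "padic_pow q x = L"
    unfolding padic_pow_def by (rule tendsto_Lim[OF nb])
  with L show ?thesis by simp
qed

lemma padic_pow_of_nat:
  assumes "padic_abs (1 - q :: 'a) < 1"
  shows "padic_pow q (of_nat m) = q ^ m"
  using tendsto_padic_pow[OF assms, of "\<lambda>_. m" "of_nat m"]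
  by (simp add: LIMSEQ_const_iff)

section \<open>Density of the natural numbers in the p-adic integers\<close>

text \<open>A rational a/b close to x has absolute value at most 1, so p does not divide b, and any
  natural n congruent to a/b modulo a high power of p is close to it.\<close>

lemma padic_integer_approx:
  assumes x: "(x::'a) \<in> padic_integers" and e: "e > 0"
  shows "\<exists>n::nat. dist (of_nat n) x < e"
proof -
  have cl: "x \<in> closure \<rat>" and x1: "padic_abs x \<le> 1"
    using x by (auto simp: padic_integers_def padic_numbers_def)
  \<comment> \<open>The bound 1 keeps y in the unit ball; the bound e is for the final
    estimate.\<close>
  obtain y where y: "y \<in> \<rat>" "dist y x < min e 1"
    using cl e by (metis closure_approachable min_less_iff_conj zero_less_one)
  have y1: "padic_abs y \<le> 1"
    using pabs_add[of "y - x" x] y(2) x1 by (auto simp: dist_eq)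
  from y(1) obtain r where r: "y = of_rat r"
    by (auto elim: Rats_cases)
  obtain a b :: int where ab: "b > 0" "coprime a b" "r = Fract a b"
    by (cases r) auto
  have y_eq: "y * of_int b = of_int a"
    using ab(1) unfolding r ab(3) by (simp add: of_rat_rat)
  have pb: "\<not> int p dvd b"
  proof
    assume "int p dvd b"
    then have "padic_abs (of_int b :: 'a) \<le> 1 / real p"
      using pabs_of_int_le[of 1 b] by simp
    moreover have "\<not> int p dvd a"
      using \<open>int p dvd b\<close> ab(2) p_gt_1 coprime_common_divisor[of a b "int p"] by auto
    ultimately have "1 \<le> padic_abs y * (1 / real p)"
      using arg_cong[OF y_eq, of padic_abs] pabs_of_int_eq_1[of a]
      by (metis mult_left_mono pabs_mult pabs_nonneg)
    also have "\<dots> \<le> 1 / real p"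
      using y1 by (simp add: divide_right_mono)
    finally show False
      using p_gt_1 by simp
  qed
  obtain k where k: "(1 / real p) ^ k < e"
    using e inverse_p_power_tendsto_0
    by (metis (no_types, lifting) eventually_sequentially order_refl order_tendstoD(2))
  have "coprime b (int p ^ k)"
    using prime_imp_coprime[of "int p" b] pb prime_p by (simp add: coprime_commute)
  then obtain c where c: "[b * c = 1] (mod int p ^ k)"
    using cong_solve_coprime_int by blast
  \<comment> \<open>c inverts b modulo p^k; reduction modulo p^k makes the representative
    nonnegative.\<close>
  define n where "n = nat ((a * c) mod int p ^ k)"
  have n: "int n = (a * c) mod int p ^ k"
    using p_gt_1 by (simp add: n_def)
  have "[b * int n = b * (a * c)] (mod int p ^ k)"
    unfolding n by (intro cong_mult cong_refl) (simp add: cong_def)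
  also have "[b * (a * c) = a * 1] (mod int p ^ k)"
    using cong_mult[OF cong_refl[of a] c] by (simp add: mult_ac)
  finally have "int p ^ k dvd b * int n - a"
    by (simp add: cong_iff_dvd_diff)
  then have "padic_abs (of_int (b * int n - a) :: 'a) \<le> (1 / real p) ^ k"
    by (rule pabs_of_int_le)
  moreover have "of_int (b * int n - a) = of_int b * (of_nat n - y)"
    using y_eq by (simp add: algebra_simps)
  ultimately have "dist (of_nat n) y < e"
    using pb k by (simp add: pabs_mult pabs_of_int_eq_1 dist_eq)
  then have "dist (of_nat n) x < e"
    using y(2) pabs_trans[of "of_nat n" x y] by (auto simp: dist_eq)
  then show ?thesis ..
qed

lemma padic_integer_limit:
  assumes "(x::'a) \<in> padic_integers"
  obtains s :: "nat \<Rightarrow> nat" where "(\<lambda>i. of_nat (s i)) \<longlonglongrightarrow> x"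
proof -
  have "\<forall>i. \<exists>n::nat. dist (of_nat n) x < inverse (real (Suc i))"
    using padic_integer_approx[OF assms] by simp
  then obtain s :: "nat \<Rightarrow> nat" where s: "\<And>i. dist (of_nat (s i)) x < inverse (real (Suc i))"
    by metis
  have "(\<lambda>i. dist (of_nat (s i)) x) \<longlonglongrightarrow> 0"
    by (rule Lim_null_comparison[OF _ LIMSEQ_inverse_real_of_nat])
      (use s in \<open>simp add: less_imp_le\<close>)
  then show ?thesis
    using that tendsto_dist_iff by blast
qed

lemma padic_pow_add_of_nat:
  assumes q: "padic_abs (1 - q :: 'a) < 1" and x: "x \<in> padic_integers"
  shows "padic_pow q (x + of_nat m) = padic_pow q x * q ^ m"
proof -
  obtain s where s: "(\<lambda>i. of_nat (s i)) \<longlonglongrightarrow> x"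
    using padic_integer_limit[OF x] .
  then have "(\<lambda>i. of_nat (s i + m)) \<longlonglongrightarrow> x + of_nat m"
    using tendsto_padic_add[OF s tendsto_const[of "of_nat m"]] by simp
  then have "(\<lambda>i. q ^ (s i + m)) \<longlonglongrightarrow> padic_pow q (x + of_nat m)"
    by (rule tendsto_padic_pow[OF q])
  moreover have "(\<lambda>i. q ^ (s i + m)) \<longlonglongrightarrow> padic_pow q x * q ^ m"
    unfolding power_add by (intro tendsto_padic_mult tendsto_padic_pow[OF q] s tendsto_const)
  ultimately show ?thesis
    by (rule LIMSEQ_unique)
qed

section \<open>Exponential polynomials and the fermionic integral\<close>

text \<open>The powers of m are there for q = 1, where the bracket is x + m; for other q pure
  exponentials suffice.\<close>

inductive expoly :: "(nat \<Rightarrow> 'a) \<Rightarrow> bool" where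
  exp_pow: "padic_abs (1 - u) < 1 \<Longrightarrow> expoly (\<lambda>m. u ^ m * of_nat m ^ k)"
| add: "expoly F \<Longrightarrow> expoly G \<Longrightarrow> expoly (\<lambda>m. F m + G m)"
| cmult: "expoly F \<Longrightarrow> expoly (\<lambda>m. c * F m)"

lemma expoly_exp: "padic_abs (1 - u) < 1 \<Longrightarrow> expoly (\<lambda>m. u ^ m)"
  using exp_pow[of u 0] by simp

lemma expoly_const: "expoly (\<lambda>m. c)"
  using cmult[OF expoly_exp[of 1], of c] by simp

lemma expoly_of_nat: "expoly of_nat"
  using exp_pow[of 1 1] by simp

lemma expoly_sum: "(\<And>i. i \<in> A \<Longrightarrow> expoly (F i)) \<Longrightarrow> expoly (\<lambda>m. \<Sum>i\<in>A. F i m)"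
  by (induction A rule: infinite_finite_induct) (auto intro: add expoly_const)

lemma expoly_mult:
  assumes "expoly F" "expoly G"
  shows "expoly (\<lambda>m. F m * G m)"
  using assms(1)
proof induction
  case (exp_pow u k)
  show ?case
    using assms(2)
  proof induction
    case (exp_pow v l)
    show ?case
      using expoly.exp_pow[OF pabs_one_minus_mult[OF \<open>padic_abs (1 - u) < 1\<close> exp_pow], of "k + l"]
      by (simp add: power_mult_distrib power_add mult_ac)
  next
    case (add F G)
    then show ?case
      using expoly.add by (simp add: ring_distribs)
  next
    case (cmult F c)
    then show ?case
      using expoly.cmult[OF cmult.IH, of c] by (simp add: mult_ac)
  qed
next
  case (add F F')
  then show ?case
    using expoly.add by (simp add: ring_distribs)
next
  case (cmult F c)
  then show ?case
    using expoly.cmult[OF cmult.IH, of c] by (simp add: mult_ac)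
qed

lemma expoly_power: "expoly F \<Longrightarrow> expoly (\<lambda>m. F m ^ k)"
  by (induction k) (auto intro: expoly_mult expoly_const)

lemma expoly_Suc: "expoly F \<Longrightarrow> expoly (\<lambda>m. F (Suc m))"
proof (induction rule: expoly.induct)
  case (exp_pow u k)
  have "expoly (\<lambda>m. (u * u ^ m) * (1 + of_nat m) ^ k)"
    using exp_pow
    by (intro expoly_mult expoly_power add expoly_const expoly_of_nat expoly_exp)
  then show ?case by simp
qed (auto intro: add cmult)

text \<open>This evaluates the boundary term of the telescoping sum: t + p^N tends to t p-adically,
  and the generators are continuous.\<close>

lemma expoly_tendsto:
  assumes "expoly F"
  shows "(\<lambda>N. F (t + p ^ N)) \<longlonglongrightarrow> F t"
  using assms
proof induction
  case (exp_pow u k)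
  have "(\<lambda>N. of_nat (p ^ N) :: 'a) \<longlonglongrightarrow> 0"
    unfolding tendsto_pabs_iff
    using pabs_of_int_le[of _ "int p ^ _"]
    by - (rule Lim_null_comparison[OF _ inverse_p_power_tendsto_0], simp)
  from tendsto_padic_add[OF tendsto_const this, of "of_nat t"]
  have t: "(\<lambda>N. of_nat (t + p ^ N) :: 'a) \<longlonglongrightarrow> of_nat t"
    by simp
  show ?case
    using tendsto_padic_pow[OF exp_pow t]
    by (intro tendsto_padic_mult tendsto_padic_power t) (simp add: padic_pow_of_nat exp_pow)
qed (auto intro: tendsto_padic_add tendsto_padic_mult)

text \<open>G(m + 1) + G(m) multiplies the leading term u^m m^k by 1 + u, which is nonzero, and
  otherwise adds only terms of lower degree in m, removed by induction on k.\<close>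

lemma expoly_antidifference:
  assumes "expoly F"
  shows "\<exists>G. expoly G \<and> (\<forall>m. G (Suc m) + G m = F m)"
  using assms
proof induction
  case (exp_pow u k)
  show ?case
  proof (induction k rule: less_induct)
    case (less k)
    then obtain H where H: "\<And>j. j < k \<Longrightarrow> expoly (H j)"
      "\<And>j m. j < k \<Longrightarrow> H j (Suc m) + H j m = u ^ m * of_nat m ^ j"
      by metis
    \<comment> \<open>The binomial theorem produces the unwanted terms u C(k, j) u^m m^j with j < k;
      the solutions \<open>H j\<close> cancel them.\<close>
    let ?G = "\<lambda>m. (1 / (1 + u)) * (u ^ m * of_nat m ^ k +
        (\<Sum>j<k. - (u * of_nat (k choose j)) * H j m))"
    have "expoly ?G"
      using H(1) exp_pow by (intro expoly.intros expoly_sum) auto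
    moreover have "?G (Suc m) + ?G m = u ^ m * of_nat m ^ k" for m
    proof -
      have "of_nat (Suc m) ^ k = (\<Sum>j\<le>k. of_nat (k choose j) * of_nat m ^ j :: 'a)"
        using binomial_ring[of "of_nat m :: 'a" 1 k] by (simp add: add.commute)
      also have "\<dots> = of_nat m ^ k + (\<Sum>j<k. of_nat (k choose j) * of_nat m ^ j)"
        by (simp flip: lessThan_Suc_atMost)
      finally have "u ^ Suc m * of_nat (Suc m) ^ k + u ^ m * of_nat m ^ k =
          (1 + u) * (u ^ m * of_nat m ^ k) +
          (\<Sum>j<k. u * of_nat (k choose j) * (u ^ m * of_nat m ^ j))"
        by (simp add: algebra_simps sum_distrib_left)
      moreover have "(\<Sum>j<k. u * of_nat (k choose j) * (u ^ m * of_nat m ^ j)) =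
          (\<Sum>j<k. u * of_nat (k choose j) * (H j (Suc m) + H j m))"
        by (rule sum.cong) (simp_all add: H(2))
      ultimately have "(u ^ Suc m * of_nat (Suc m) ^ k +
            (\<Sum>j<k. - (u * of_nat (k choose j)) * H j (Suc m))) +
          (u ^ m * of_nat m ^ k + (\<Sum>j<k. - (u * of_nat (k choose j)) * H j m)) =
          (1 + u) * (u ^ m * of_nat m ^ k)"
        by (simp add: distrib_left sum.distrib sum_negf diff_add_eq add_diff_eq diff_diff_eq
            del: of_nat_Suc power_Suc)
      then have "?G (Suc m) + ?G m = (1 / (1 + u)) * ((1 + u) * (u ^ m * of_nat m ^ k))"
        by (simp only: flip: distrib_left)
      then show ?thesis
        using one_plus_neq_0[OF exp_pow] by simp
    qed
    ultimately show ?case by blast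
  qed
next
  case (add F F')
  then obtain G G' where "expoly G" "expoly G'" "\<And>m. G (Suc m) + G m = F m"
    "\<And>m. G' (Suc m) + G' m = F' m"
    by blast
  then show ?case
    by (intro exI[of _ "\<lambda>m. G m + G' m"]) (auto intro: expoly.add simp: algebra_simps)
next
  case (cmult F c)
  then obtain G where "expoly G" "\<And>m. G (Suc m) + G m = F m"
    by blast
  then show ?case
    by (intro exI[of _ "\<lambda>m. c * G m"]) (auto intro: expoly.cmult simp flip: distrib_left)
qed

section \<open>The fermionic integral as an operator on sequences\<close>

text \<open>Keeping the shift t as an argument makes the r-fold integral the r-th iterate of one
  operator.\<close>

definition fermionic_shift :: "(nat \<Rightarrow> 'a) \<Rightarrow> nat \<Rightarrow> 'a" where
  "fermionic_shift F t = lim (\<lambda>N. \<Sum>y<p ^ N. F (t + y) * (-1) ^ y)"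

lemma alternating_sum_telescope:
  fixes G :: "nat \<Rightarrow> 'b::comm_ring_1"
  assumes "odd n"
  shows "(\<Sum>y<n. (G (Suc (t + y)) + G (t + y)) * (-1) ^ y) = G t + G (t + n)"
proof -
  \<comment> \<open>The induction runs over all n; oddness only fixes the sign of the boundary term
    afterwards.\<close>
  have "(\<Sum>y<n. (G (Suc (t + y)) + G (t + y)) * (-1) ^ y) = G t - (-1) ^ n * G (t + n)"
    by (induction n) (simp_all add: algebra_simps)
  with assms show ?thesis by simp
qed

text \<open>For an antidifference G of F both boundary terms of the telescoped sum tend to G t, so
  the integral is 2 G t.\<close>

lemma fermionic_shift_expoly:
  assumes "expoly F"
  shows "expoly (fermionic_shift F)"
    and "fermionic_shift F (Suc m) + fermionic_shift F m = 2 * F m"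
proof -
  obtain G where G: "expoly G" "\<And>m. G (Suc m) + G m = F m"
    using expoly_antidifference[OF assms] by blast
  have "fermionic_shift F t = 2 * G t" for t
  proof -
    have "(\<Sum>y<p ^ N. F (t + y) * (-1) ^ y) = G t + G (t + p ^ N)" for N
      using alternating_sum_telescope[of "p ^ N" G t] odd_p by (simp add: G(2))
    moreover have "(\<lambda>N. G t + G (t + p ^ N)) \<longlonglongrightarrow> G t + G t"
      by (intro tendsto_padic_add tendsto_const expoly_tendsto G(1))
    ultimately show ?thesis
      unfolding fermionic_shift_def by (simp add: limI)
  qed
  then have *: "fermionic_shift F = (\<lambda>t. 2 * G t)" ..
  show "expoly (fermionic_shift F)"
    unfolding * by (rule cmult[OF G(1)])
  show "fermionic_shift F (Suc m) + fermionic_shift F m = 2 * F m"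
    unfolding * G(2)[of m, symmetric] by (rule distrib_left[symmetric])
qed

text \<open>Variables fixed by the outer integrals enter the inner ones only through their sum, that
  is, as a larger shift t; hence the induction is over all t and f.\<close>

lemma iterated_fermionic_integral_eq:
  assumes "\<And>ms. f (map of_nat ms) = F (t + sum_list ms)"
  shows "iterated_fermionic_integral p r f = (fermionic_shift ^^ r) F t"
  using assms
proof (induction r arbitrary: f t)
  case 0
  from 0[of "[]"] show ?case by simp
next
  case (Suc r)
  have "iterated_fermionic_integral p r (\<lambda>ys. f (of_nat y # ys)) = (fermionic_shift ^^ r) F (t + y)"
    for y
    using Suc.prems[of "y # _"] by (intro Suc.IH) (simp add: add.assoc)
  then show ?case
    by (simp add: fermionic_integral_def fermionic_shift_def[of "(fermionic_shift ^^ r) F"])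
qed

section \<open>Evaluation of the series\<close>

lemma rational_summable_neg_binomial_expoly:
  assumes "expoly F"
  shows "rational_summable (\<lambda>m. neg_binomial r m * F m)"
  using assms
proof induction
  case (exp_pow u k)
  then show ?case
    by (intro rational_summable_neg_binomial_exp_pow one_plus_neq_0)
next
  case (add F G)
  then show ?case
    unfolding rational_summable_def using rational_sums_add by (fastforce simp: ring_distribs)
next
  case (cmult F c)
  then obtain s where "(\<lambda>m. neg_binomial r m * F m) rational_sums s"
    unfolding rational_summable_def by blast
  from rational_sums_cmult[OF this, of c] show ?case
    unfolding rational_summable_def by (auto simp: mult_ac)
qed

lemma rational_sums_neg_binomial_expoly:
  assumes "expoly F"
  shows "(\<lambda>m. neg_binomial r m * F m) rational_sums ((fermionic_shift ^^ r) F 0 / 2 ^ r)"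
  using assms
proof (induction r arbitrary: F)
  case 0
  \<comment> \<open>At order 0 all coefficients beyond m = 0 vanish, leaving a constant polynomial
    over the denominator 1.\<close>
  have "Abs_fps (\<lambda>m. neg_binomial 0 m * F m) = fps_of_poly [:F 0:]"
    by (rule fps_ext) (case_tac n; simp)
  then show ?case
    unfolding rational_sums_def by (intro exI[of _ "[:F 0:]"] exI[of _ 1]) simp
next
  case (Suc r)
  let ?G = "fermionic_shift F"
  have G: "expoly ?G"
    by (rule fermionic_shift_expoly[OF Suc.prems])
  have "(\<lambda>m. neg_binomial (Suc r) m * (?G (Suc m) + ?G m)) rational_sums
      ((fermionic_shift ^^ r) ?G 0 / 2 ^ r)"
    by (intro rational_sums_neg_binomial_by_parts rational_summable_neg_binomial_expoly
        expoly_Suc G Suc.IH)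
  \<comment> \<open>The factor 1/2 cancels the 2 in \<open>2 * F m\<close> and raises the
    denominator to \<open>2 ^ Suc r\<close>.\<close>
  from rational_sums_cmult[OF this, of "1 / 2"] show ?case
    by (simp add: fermionic_shift_expoly(2)[OF Suc.prems] funpow_swap1)
qed

text \<open>For q other than 1, the law q^(x+m) = q^x q^m makes the bracket an affine function of
  q^m.\<close>

lemma expoly_q_bracket:
  assumes q: "padic_abs (1 - q :: 'a) < 1" and x: "x \<in> padic_integers"
  shows "expoly (\<lambda>m. q_bracket q (x + of_nat m))"
proof (cases "q = 1")
  case True
  then show ?thesis
    using add[OF expoly_const[of x] expoly_of_nat] by (simp add: q_bracket_def)
next
  case False
  have "expoly (\<lambda>m. 1 / (1 - q) * (1 + (- padic_pow q x) * q ^ m))"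
    by (rule cmult[OF add[OF expoly_const cmult[OF expoly_exp[OF q]]]])
  then show ?thesis
    using False by (simp add: q_bracket_def padic_pow_add_of_nat[OF q x])
qed

end

theorem theorem3:
  fixes p r n :: nat
    and q w x :: "'a::{field_char_0, complete_space}"
  assumes "prime p" and "odd p"
    and "padic_complex_field p TYPE('a)"
    and "padic_abs (1 - q) < 1" and "padic_abs (1 - w) < 1"
    and "r \<ge> 1"
    and "x \<in> padic_integers"
  shows "rational_summable (\<lambda>m. of_nat ((m + r - 1) choose m) * (-1) ^ m * w ^ m *
             q_bracket q (of_nat m + x) ^ n) \<and>
         euler_poly p r n w q x =
           2 ^ r * rational_suminf (\<lambda>m. of_nat ((m + r - 1) choose m) * (-1) ^ m * w ^ m *
             q_bracket q (of_nat m + x) ^ n)"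
proof -
  interpret padic_complex p "TYPE('a)"
    using assms(1-3) by unfold_locales
  let ?F = "\<lambda>m. w ^ m * q_bracket q (x + of_nat m) ^ n"
  have "expoly ?F"
    by (rule expoly_mult[OF expoly_exp[OF assms(5)] expoly_power[OF expoly_q_bracket[OF assms(4,7)]]])
  from rational_sums_neg_binomial_expoly[OF this, of r]
  have sums: "(\<lambda>m. of_nat ((m + r - 1) choose m) * (-1) ^ m * w ^ m * q_bracket q (of_nat m + x) ^ n)
      rational_sums ((fermionic_shift ^^ r) ?F 0 / 2 ^ r)"
    by (simp add: neg_binomial_def add.commute mult.assoc)
  \<comment> \<open>At natural arguments the sum of the variables is again natural, so
    \<open>padic_pow w\<close> is an ordinary power there.\<close>
  have "sum_list (map of_nat ms) = (of_nat (sum_list ms) :: 'a)" for ms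
    by (induction ms) simp_all
  then have "euler_poly p r n w q x = (fermionic_shift ^^ r) ?F 0"
    unfolding euler_poly_def
    by (intro iterated_fermionic_integral_eq) (simp add: padic_pow_of_nat assms(5))
  with sums show ?thesis
    by (auto simp: rational_summable_def rational_suminf_eqI)
qed

end
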